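(* There exists a cylinder packing $\mathcal{C}$ in $\mathbf{R}^3$ whose global density is $1/2$, and such that no two (distinct) cylinders in $\mathcal{C}$ are parallel.
   Context: For a line $l$ in $\mathbf{R}^3$ and a real $r>0$, the (infinite circular) cylinder of axis $l$ and radius $r$ is the set of points of $\mathbf{R}^3$ whose distance from $l$ is at most $r$. Two cylinders are parallel if their axes are parallel. A cylinder packing is a collection $\mathcal{C}=\{C_i\}_{i=1}^{\infty}$ of congruent cylinders (all of the same radius) whose interiors are mutually disjoint. Let $B(R)$ be the ball of radius $R$ centered at the origin. The local density of $\mathcal{C}$ with respect to $B(R)$ is $$\delta(\mathcal{C},R)=\frac{\sum_{i=1}^{\infty}Vol(C_i\cap B(R))}{4\pi R^3/3},$$ and the global density of $\mathcal{C}$ is $\delta(\mathcal{C})=\lim_{R\to\infty}\delta(\mathcal{C},R)$, provided the limit exists. *)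

theory Defs
  imports "HOL-Analysis.Analysis"
begin

definition is_line :: "(real^3) set \<Rightarrow> bool" where
  "is_line l \<longleftrightarrow> affine l \<and> aff_dim l = 1"

definition cylinder :: "(real^3) set \<Rightarrow> real \<Rightarrow> (real^3) set" where
  "cylinder l r = {x. infdist x l \<le> r}"

(* A cylinder is a point set; its axis and radius are determined by that set.
   affine_parallel says that one axis is a translate of the other, so that
   coinciding axes count as parallel. *)
definition parallel_cylinders :: "(real^3) set \<Rightarrow> (real^3) set \<Rightarrow> bool" where
  "parallel_cylinders C D \<longleftrightarrow>
     (\<exists>l m r s. is_line l \<and> is_line m \<and> 0 < r \<and> 0 < s \<and>
        C = cylinder l r \<and> D = cylinder m s \<and> affine_parallel l m)"

definition cylinder_packing :: "(nat \<Rightarrow> (real^3) set) \<Rightarrow> bool" where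
  "cylinder_packing C \<longleftrightarrow>
     (\<exists>r>0. \<forall>i. \<exists>l. is_line l \<and> C i = cylinder l r) \<and>
     disjoint_family (\<lambda>i. interior (C i))"

(* For a cylinder packing the series always converges: the interiors are
   disjoint and the boundaries are null sets, so the partial sums are bounded
   by the volume of the ball. *)
definition local_density :: "(nat \<Rightarrow> (real^3) set) \<Rightarrow> real \<Rightarrow> real" where
  "local_density C R =
     (\<Sum>i. measure lebesgue (C i \<inter> cball 0 R)) / (4 * pi * R ^ 3 / 3)"

definition has_global_density :: "(nat \<Rightarrow> (real^3) set) \<Rightarrow> real \<Rightarrow> bool" where
  "has_global_density C d \<longleftrightarrow> (local_density C \<longlongrightarrow> d) at_top"

end

theory Submission
  imports Defs
begin

text \<open>
  The axes are almost vertical lines, one through each point \<open>(m, n)\<close> of the integer lattice of the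
  horizontal plane. A line through \<open>a\<close> with direction \<open>(v a, 1)\<close> and a line through \<open>b\<close> with
  direction \<open>(v b, 1)\<close> keep their distance when the vectors \<open>a - b\<close> and \<open>v a - v b\<close> are close to
  perpendicular: the twisting of the bundle then only moves points apart as the height changes. So let \<open>v\<close> be
  a field \<open>u\<close> turned by a right angle, with \<open>u a - u b\<close> pointing roughly along \<open>a - b\<close>. On the lattice
  the choice \<open>u (m, n) = (tilt m, tilt n)\<close> with one strictly increasing function \<open>tilt\<close> works: both
  coordinates of \<open>u a - u b\<close> have the same sign as those of \<open>a - b\<close>, and the distance of two lines is at
  least 1 up to a factor that depends only on the bound for \<open>tilt\<close>
  (\<open>grid_line_separation\<close>). Strict monotonicity makes all directions different, and
  \<open>tilt\<close> can be bounded by any positive constant, so that the lines stay as steep as desired.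
  Congruent cylinders of every radius up to nearly \<open>1 / 2\<close> can be put around these lines.

  It remains to compute the density. A cylinder of radius \<open>r\<close> whose axis has distance \<open>D\<close> from the
  origin meets the ball of radius \<open>R\<close> in a volume close to \<open>2 * pi * r\<^sup>2 * sqrt (R\<^sup>2 - D\<^sup>2)\<close>
  (\<open>measure_cylinder_Int_cball_ge\<close>, \<open>measure_cylinder_Int_cball_le\<close>). Since \<open>tilt\<close> converges in both
  directions, the bundle converges under rescaling by \<open>1 / R\<close> to a family of lines with one
  direction per quadrant. Writing the sum over the lattice as an integral over the plane, dominated
  convergence gives the global density \<open>3 / 2 * r\<^sup>2 * I\<close> (\<open>local_density_grid_tendsto\<close>), where \<open>I\<close>
  integrates half the length that the unit ball cuts out of the limiting line through a point. A line through
  \<open>p\<close> comes at least as close to the origin as \<open>p\<close>, so \<open>I\<close> is at least the volume of the unit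
  half-ball, and the density at least \<open>pi * r\<^sup>2\<close>. With \<open>r\<close> nearly \<open>1 / 2\<close> this exceeds \<open>1 / 2\<close>;
  hence some smaller radius gives density exactly \<open>1 / 2\<close>, namely \<open>r\<^sup>2 = 1 / (3 * I)\<close>.
\<close>

section \<open>The volume of a piece of a cylinder\<close>

lemma borel_measurable_vector3:
  "(\<lambda>p. vector [fst (fst p), snd (fst p), snd p] :: real^3) \<in> borel_measurable borel" (is "?f \<in> _")
proof -
  have "?f = (\<lambda>p. fst (fst p) *\<^sub>R axis 1 1 + snd (fst p) *\<^sub>R axis 2 1 + snd p *\<^sub>R axis 3 1)"
    by (auto simp: fun_eq_iff vec_eq_iff forall_3 axis_def)
  then show ?thesis
    by (auto intro!: borel_measurable_continuous_onI continuous_intros)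
qed

text \<open>The isometry with \<open>(\<real> \<times> \<real>) \<times> \<real>\<close> gives access to the product measure, and so to the volume
  of an upright cylinder as disk area times height.\<close>

lemma lborel_real3_eq_distr:
  "(lborel :: (real^3) measure) =
     distr (lborel :: ((real \<times> real) \<times> real) measure) borel (\<lambda>p. vector [fst (fst p), snd (fst p), snd p])"
    (is "_ = distr _ _ ?f")
proof (rule lborel_eqI)
  note meas = borel_measurable_vector3
  fix l u :: "real^3"
  assume le: "\<And>b. b \<in> Basis \<Longrightarrow> l \<bullet> b \<le> u \<bullet> b"
  have le': "l $ i \<le> u $ i" for i
    using le[of "axis i 1"] by (simp add: axis_in_Basis_iff inner_axis)
  have "?f -` box l u = (box (l$1) (u$1) \<times> box (l$2) (u$2)) \<times> box (l$3) (u$3)"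
    by (auto simp: mem_box_cart forall_3)
  moreover have "emeasure lborel ((box (l$1) (u$1) \<times> box (l$2) (u$2)) \<times> box (l$3) (u$3)) =
      ennreal (u$1 - l$1) * ennreal (u$2 - l$2) * ennreal (u$3 - l$3)"
    using le' unfolding lborel_prod[symmetric]
    by (simp add: lborel.emeasure_pair_measure_Times)
  moreover have "(\<Prod>b\<in>Basis. (u - l) \<bullet> b) = (u$1 - l$1) * (u$2 - l$2) * (u$3 - l$3)"
  proof -
    have B: "Basis = {axis 1 1, axis 2 1, axis 3 (1::real) :: real^3}"
      by (auto simp: Basis_vec_def UNIV_3)
    moreover have "axis 1 1 \<noteq> (axis 2 1 :: real^3)" "axis 1 1 \<noteq> (axis 3 1 :: real^3)"
        "axis 2 1 \<noteq> (axis 3 1 :: real^3)"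
      by (simp_all add: axis_eq_axis)
    ultimately show ?thesis
      unfolding B by (simp add: inner_axis mult.assoc)
  qed
  ultimately show "emeasure (distr lborel borel ?f) (box l u) = (\<Prod>b\<in>Basis. (u - l) \<bullet> b)"
    using le' meas by (simp add: emeasure_distr ennreal_mult)
qed simp

lemma measure_upright_cylinder:
  assumes "0 \<le> r" "0 \<le> h"
  defines "Z \<equiv> {x::real^3. (x$1)\<^sup>2 + (x$2)\<^sup>2 \<le> r\<^sup>2 \<and> \<bar>x$3\<bar> \<le> h}"
  shows "Z \<in> lmeasurable" "measure lebesgue Z = 2 * pi * r\<^sup>2 * h"
proof -
  let ?f = "\<lambda>p. vector [fst (fst p), snd (fst p), snd p] :: real^3"
  note meas = borel_measurable_vector3
  have closed: "closed Z"
    unfolding Z_def by (intro closed_Collect_conj closed_Collect_le continuous_intros)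
  have "?f -` Z = cball 0 r \<times> {-h..h}"
    using \<open>0 \<le> r\<close> by (auto simp: Z_def norm_prod_def real_sqrt_le_iff' sqrt_le_D intro: real_le_lsqrt)
  then have "emeasure lborel Z = emeasure lborel (cball (0 :: real \<times> real) r \<times> {-h..h})"
    using closed meas by (subst lborel_real3_eq_distr) (simp add: emeasure_distr)
  also have "\<dots> = ennreal (2 * pi * r\<^sup>2 * h)"
    unfolding lborel_prod[symmetric, where ?'a = "real \<times> real"]
    using assms
    by (simp add: lborel.emeasure_pair_measure_Times emeasure_cball unit_ball_vol_2 power2_eq_square mult_ac
        flip: ennreal_mult)
  finally have *: "emeasure lebesgue Z = ennreal (2 * pi * r\<^sup>2 * h)"
    using closed by simp
  then show "measure lebesgue Z = 2 * pi * r\<^sup>2 * h"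
    using assms by (simp add: measure_def)
  show "Z \<in> lmeasurable"
    using * closed by (intro fmeasurableI) auto
qed


text \<open>Taking for \<open>p\<close> the foot of the perpendicular from the origin makes \<open>norm p\<close> the distance of the
  line from the origin, which is the only parameter of a line that the volume estimates see.\<close>

lemma is_line_foot:
  assumes "is_line l"
  obtains p w where "norm w = 1" "p \<bullet> w = 0" "l = range (\<lambda>t. p + t *\<^sub>R w)"
proof -
  have aff: "affine l" and dim: "aff_dim l = 1"
    using assms by (auto simp: is_line_def)
  obtain b where b: "\<not> affine_dependent b" "l = affine hull b" "card b = 2" "finite b"
    using aff_dim_basis_exists[of l] dim aff aff_independent_finite by (metis affine_hull_eq add_diff_cancel_right' diff_eq_eq of_nat_eq_iff of_nat_numeral one_add_one)
  then obtain x y where xy: "b = {x, y}" "x \<noteq> y"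
    by (auto simp: card_2_iff)
  define w where "w = (y - x) /\<^sub>R norm (y - x)"
  have w: "norm w = 1"
    using xy by (simp add: w_def)
  then have ww: "w \<bullet> w = 1"
    by (simp add: dot_square_norm)
  define p where "p = x - (x \<bullet> w) *\<^sub>R w"
  have l: "l = range (\<lambda>t. x + t *\<^sub>R (y - x))"
    unfolding b(2) xy(1) affine_hull_2_alt by (simp add: full_SetCompr_eq)
  have "l = range (\<lambda>t. p + t *\<^sub>R w)"
  proof -
    have "x + t *\<^sub>R (y - x) = p + (x \<bullet> w + t * norm (y - x)) *\<^sub>R w" for t
      using xy by (simp add: p_def w_def algebra_simps)
    moreover have "p + t *\<^sub>R w = x + ((t - x \<bullet> w) / norm (y - x)) *\<^sub>R (y - x)" for t
      using xy by (simp add: p_def w_def algebra_simps divide_inverse)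
    ultimately show ?thesis
      unfolding l by (metis (no_types, lifting) rangeI subset_antisym image_subset_iff)
  qed
  moreover have "p \<bullet> w = 0"
    by (simp add: p_def inner_diff_left ww)
  ultimately show ?thesis
    using w that by blast
qed

lemma is_line_range:
  assumes "w \<noteq> 0"
  shows "is_line (range (\<lambda>t. p + t *\<^sub>R w))"
proof -
  have "range (\<lambda>t. p + t *\<^sub>R w) = affine hull {p, p + w}"
    unfolding affine_hull_2_alt by (simp add: full_SetCompr_eq)
  then show ?thesis
    using assms by (simp add: is_line_def aff_dim_affine_hull)
qed

lemma infdist_line:
  fixes p w x :: "'a::euclidean_space"
  assumes "norm w = 1"
  shows "infdist x (range (\<lambda>t. p + t *\<^sub>R w)) = norm (x - p - ((x - p) \<bullet> w) *\<^sub>R w)"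
    (is "infdist x ?l = norm ?y")
proof (rule antisym)
  have "infdist x ?l \<le> dist x (p + ((x - p) \<bullet> w) *\<^sub>R w)"
    by (intro infdist_le rangeI)
  then show "infdist x ?l \<le> norm ?y"
    by (simp add: dist_norm algebra_simps)
  have ww: "w \<bullet> w = 1"
    using assms by (simp add: dot_square_norm)
  have "norm ?y \<le> dist x a" if "a \<in> ?l" for a
  proof -
    from that obtain t where t: "a = p + t *\<^sub>R w"
      by blast
    have "x - a = ?y + ((x - p) \<bullet> w - t) *\<^sub>R w"
      by (simp add: t algebra_simps)
    moreover have "orthogonal ?y (((x - p) \<bullet> w - t) *\<^sub>R w)"
      by (simp add: orthogonal_def inner_diff_left ww)
    ultimately have "(dist x a)\<^sup>2 = (norm ?y)\<^sup>2 + (norm (((x - p) \<bullet> w - t) *\<^sub>R w))\<^sup>2"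
      by (metis dist_norm norm_add_Pythagorean)
    then show ?thesis
      by (smt (verit) power2_le_imp_le zero_le_dist zero_le_power2)
  qed
  then show "norm ?y \<le> infdist x ?l"
    by (auto simp: infdist_def intro!: cINF_greatest)
qed

text \<open>A rigid motion takes the piece of length \<open>2 * h\<close> of an arbitrary cylinder to an upright one.\<close>

lemma measure_cylinder_piece:
  fixes p w :: "real^3"
  assumes "norm w = 1" "0 \<le> r" "0 \<le> h"
  defines "S \<equiv> {x. norm (x - p - ((x - p) \<bullet> w) *\<^sub>R w) \<le> r \<and> \<bar>(x - p) \<bullet> w\<bar> \<le> h}"
  shows "S \<in> lmeasurable" "measure lebesgue S = 2 * pi * r\<^sup>2 * h"
proof -
  define Z where "Z = {x::real^3. (x$1)\<^sup>2 + (x$2)\<^sup>2 \<le> r\<^sup>2 \<and> \<bar>x$3\<bar> \<le> h}"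
  have Z: "Z \<in> lmeasurable" "measure lebesgue Z = 2 * pi * r\<^sup>2 * h"
    using measure_upright_cylinder[OF assms(2,3)] by (simp_all add: Z_def)
  obtain f :: "real^3 \<Rightarrow> real^3" where f: "orthogonal_transformation f" "f (axis 3 1) = w"
    using orthogonal_transformation_exists_1[of "axis 3 1 :: real^3" w] assms(1)
    by (metis norm_axis_1)
  have lin: "linear f"
    using f(1) by (simp add: orthogonal_transformation_def)
  have dot: "f y \<bullet> w = y $ 3" for y
    using f by (metis inner_axis inner_real_def mult.right_neutral orthogonal_transformation_def)
  have nrm: "norm (f y - (f y \<bullet> w) *\<^sub>R w) = sqrt ((y$1)\<^sup>2 + (y$2)\<^sup>2)" for y
  proof -
    have "f y - (f y \<bullet> w) *\<^sub>R w = f (y - (y$3) *\<^sub>R axis 3 1)"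
      by (simp add: dot f(2) linear_diff[OF lin] linear_scale[OF lin])
    moreover have "norm (y - (y$3) *\<^sub>R axis 3 1) = sqrt ((y$1)\<^sup>2 + (y$2)\<^sup>2)"
      by (simp add: norm_vec_def L2_set_def sum_3 axis_def)
    ultimately show ?thesis
      using f(1) by (simp add: orthogonal_transformation)
  qed
  have "y \<in> Z \<longleftrightarrow> p + f y \<in> S" for y
    using \<open>0 \<le> r\<close> nrm[of y] dot[of y] 
    by (simp add: Z_def S_def sqrt_le_D real_sqrt_le_iff' real_le_lsqrt)
  moreover have "\<exists>y. x = p + f y" for x
    using orthogonal_transformation_surj[OF f(1)] by (metis add_diff_cancel_left' add_diff_eq surjD)
  ultimately have S: "S = (+) p ` f ` Z"
    by (auto simp: image_iff) metis
  show "S \<in> lmeasurable" "measure lebesgue S = 2 * pi * r\<^sup>2 * h"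
    unfolding S using Z f(1)
    by (simp_all add: measurable_orthogonal_image measure_orthogonal_image measurable_translation measure_translation)
qed

text \<open>The points of a cylinder have distance between \<open>D - r\<close> and \<open>D + r\<close> from the line through the
  origin parallel to the axis, \<open>D\<close> being the distance of the axis from the origin. By Pythagoras the
  cylinder therefore meets the ball in a set caught between two straight pieces whose half-lengths are
  the legs of right triangles with hypotenuse \<open>R\<close>.\<close>

lemma
  fixes l :: "(real^3) set"
  assumes "is_line l" "0 \<le> r" "0 \<le> R"
  shows measure_cylinder_Int_cball_ge:
      "2 * pi * r\<^sup>2 * sqrt (max 0 (R\<^sup>2 - (infdist 0 l + r)\<^sup>2)) \<le> measure lebesgue (cylinder l r \<inter> cball 0 R)"
        (is "?lower \<le> ?V")
    and measure_cylinder_Int_cball_le: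
      "measure lebesgue (cylinder l r \<inter> cball 0 R)
         \<le> 2 * pi * r\<^sup>2 * sqrt (max 0 (R\<^sup>2 - (max 0 (infdist 0 l - r))\<^sup>2))" (is "_ \<le> ?upper")
proof -
  obtain p w where w: "norm w = 1" and pw: "p \<bullet> w = 0" and l: "l = range (\<lambda>t. p + t *\<^sub>R w)"
    using is_line_foot[OF assms(1)] by blast
  have D: "infdist 0 l = norm p"
    by (simp add: l infdist_line[OF w] pw)
  have ww: "w \<bullet> w = 1"
    using w by (simp add: dot_square_norm)
  \<comment> \<open>the component of \<open>x\<close> perpendicular to the axis\<close>
  define y where "y x = x - (x \<bullet> w) *\<^sub>R w" for x
  have cyl: "x \<in> cylinder l r \<longleftrightarrow> norm (y x - p) \<le> r" for x
    by (simp add: cylinder_def l infdist_line[OF w] y_def inner_diff_left pw algebra_simps)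
  have pyth: "(norm x)\<^sup>2 = (norm (y x))\<^sup>2 + (x \<bullet> w)\<^sup>2" for x
  proof -
    have "x = y x + (x \<bullet> w) *\<^sub>R w" "orthogonal (y x) ((x \<bullet> w) *\<^sub>R w)"
      by (simp_all add: y_def orthogonal_def inner_diff_left ww)
    then have "(norm x)\<^sup>2 = (norm (y x))\<^sup>2 + (norm ((x \<bullet> w) *\<^sub>R w))\<^sup>2"
      by (metis norm_add_Pythagorean)
    then show ?thesis
      using w by simp
  qed
  define S where "S h = {x. norm (y x - p) \<le> r \<and> \<bar>x \<bullet> w\<bar> \<le> h}" for h
  have "S h = {x. norm (x - p - ((x - p) \<bullet> w) *\<^sub>R w) \<le> r \<and> \<bar>(x - p) \<bullet> w\<bar> \<le> h}" for h
    by (simp add: S_def y_def inner_diff_left pw algebra_simps)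
  then have S: "S h \<in> lmeasurable" "measure lebesgue (S h) = 2 * pi * r\<^sup>2 * h" if "0 \<le> h" for h
    using measure_cylinder_piece[OF w \<open>0 \<le> r\<close> that] by simp_all
  have closed: "closed (cylinder l r \<inter> cball 0 R)"
    unfolding cylinder_def by (intro closed_Int closed_Collect_le continuous_intros closed_cball)
  have sets: "cylinder l r \<inter> cball 0 R \<in> lmeasurable"
    using closed by (intro lmeasurable_compact) (simp add: compact_eq_bounded_closed bounded_Int)
  show "?lower \<le> ?V"
  proof (cases "(infdist 0 l + r)\<^sup>2 \<le> R\<^sup>2")
    case True
    define h where "h = sqrt (R\<^sup>2 - (norm p + r)\<^sup>2)"
    have h: "0 \<le> h" "h\<^sup>2 = R\<^sup>2 - (norm p + r)\<^sup>2"
      using True by (simp_all add: h_def D)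
    have "S h \<subseteq> cylinder l r \<inter> cball 0 R"
    proof
      fix x assume x: "x \<in> S h"
      then have "norm (y x) \<le> norm p + r"
        by (auto simp: S_def) (smt (verit) norm_triangle_sub)
      then have "(norm (y x))\<^sup>2 \<le> (norm p + r)\<^sup>2"
        by (simp add: power_mono)
      moreover have "(x \<bullet> w)\<^sup>2 \<le> h\<^sup>2"
        using x h(1) by (intro abs_le_square_iff[THEN iffD1]) (simp add: S_def)
      ultimately have "(norm x)\<^sup>2 \<le> R\<^sup>2"
        using h(2) pyth[of x] by linarith
      then have "norm x \<le> R"
        using \<open>0 \<le> R\<close> by (rule power2_le_imp_le)
      then show "x \<in> cylinder l r \<inter> cball 0 R"
        using x by (simp add: S_def cyl)
    qed
    then have "measure lebesgue (S h) \<le> ?V"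
      using S(1)[OF h(1)] sets by (intro measure_mono_fmeasurable) auto
    then show ?thesis
      using True S(2)[OF h(1)] by (simp add: h_def D)
  qed simp
  define h where "h = sqrt (max 0 (R\<^sup>2 - (max 0 (norm p - r))\<^sup>2))"
  have "cylinder l r \<inter> cball 0 R \<subseteq> S h"
  proof
    fix x assume x: "x \<in> cylinder l r \<inter> cball 0 R"
    then have "max 0 (norm p - r) \<le> norm (y x)"
      by (simp add: cyl) (smt (verit) norm_minus_commute norm_triangle_sub norm_ge_zero)
    then have "(max 0 (norm p - r))\<^sup>2 \<le> (norm (y x))\<^sup>2"
      by (simp add: power_mono)
    moreover have "(norm x)\<^sup>2 \<le> R\<^sup>2"
      using x by (simp add: power_mono)
    ultimately have "(x \<bullet> w)\<^sup>2 \<le> R\<^sup>2 - (max 0 (norm p - r))\<^sup>2"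
      using pyth[of x] by linarith
    then have "\<bar>x \<bullet> w\<bar> \<le> h"
      unfolding h_def by (intro real_le_rsqrt) auto
    then show "x \<in> S h"
      using x by (simp add: S_def cyl)
  qed
  moreover have "0 \<le> h"
    by (simp add: h_def)
  ultimately have "?V \<le> measure lebesgue (S h)"
    using S(1) sets by (intro measure_mono_fmeasurable) auto
  then show "?V \<le> ?upper"
    using S(2)[OF \<open>0 \<le> h\<close>] by (simp add: h_def D)
qed

section \<open>A square grid of twisted lines\<close>

lemma infdist_line_squared:
  fixes p w x :: "'a::euclidean_space"
  assumes "w \<noteq> 0"
  shows "(infdist x (range (\<lambda>t. p + t *\<^sub>R w)))\<^sup>2 = (norm (x - p))\<^sup>2 - ((x - p) \<bullet> w)\<^sup>2 / (norm w)\<^sup>2"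
proof -
  define v where "v = w /\<^sub>R norm w"
  have v: "norm v = 1"
    using assms by (simp add: v_def)
  then have vv: "v \<bullet> v = 1"
    by (simp add: dot_square_norm)
  have w: "w = norm w *\<^sub>R v"
    using assms by (simp add: v_def)
  have "range (\<lambda>t. p + t *\<^sub>R w) = range (\<lambda>t. p + t *\<^sub>R v)"
  proof -
    have "p + t *\<^sub>R w = p + (t * norm w) *\<^sub>R v" for t
      using assms by (simp add: v_def)
    moreover have "p + t *\<^sub>R v = p + (t / norm w) *\<^sub>R w" for t
      using assms by (simp add: v_def divide_inverse)
    ultimately show ?thesis
      by (metis (no_types, lifting) rangeI subset_antisym image_subset_iff)
  qed
  then have "(infdist x (range (\<lambda>t. p + t *\<^sub>R w)))\<^sup>2 = (norm (x - p - ((x - p) \<bullet> v) *\<^sub>R v))\<^sup>2"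
    by (simp add: infdist_line[OF v])
  also have "\<dots> = (norm (x - p))\<^sup>2 - ((x - p) \<bullet> v)\<^sup>2"
    unfolding power2_norm_eq_inner
    by (simp add: inner_diff_left inner_diff_right vv inner_commute power2_eq_square algebra_simps)
  also have "(x - p) \<bullet> v = ((x - p) \<bullet> w) / norm w"
    by (simp add: v_def divide_inverse)
  finally show ?thesis
    by (simp add: power_divide)
qed

text \<open>The construction needs only that the tilt is strictly increasing, bounded by a small constant, and
  convergent at \<open>\<plusminus>\<infinity>\<close>. The bound \<open>1 / 8\<close> is small enough that the loss in the separation of the
  lines is harmless for density \<open>1 / 2\<close>.\<close>

definition tilt :: "int \<Rightarrow> real" where
  "tilt m = of_int m / (8 * (1 + \<bar>of_int m\<bar>))"

lemma tilt_bound: "\<bar>tilt m\<bar> \<le> 1 / 8"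
  by (simp add: tilt_def abs_mult field_simps)

lemma tilt_strict_mono: "strict_mono tilt"
proof (rule strict_monoI)
  fix m n :: int
  assume "m < n"
  then have mn: "real_of_int m < real_of_int n"
    by simp
  have less: "a * (1 + \<bar>b\<bar>) < b * (1 + \<bar>a\<bar>)" if "a < b" for a b :: real
  proof -
    have "a * \<bar>b\<bar> \<le> b * \<bar>a\<bar>"
      using that by (cases "0 \<le> a"; cases "0 \<le> b") (auto simp: mult_nonneg_nonpos2 mult_nonpos_nonneg mult_nonneg_nonpos)
    then show ?thesis
      using that by (simp add: algebra_simps)
  qed
  have "a / (8 * (1 + \<bar>a\<bar>)) < b / (8 * (1 + \<bar>b\<bar>))" if "a < b" for a b :: real
  proof -
    have "0 < 8 * (1 + \<bar>a\<bar>)" "0 < 8 * (1 + \<bar>b\<bar>)"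
      by auto
    then show ?thesis
      using less[OF that] by (simp add: pos_divide_less_eq pos_less_divide_eq del: zero_less_mult_iff) (simp add: algebra_simps)
  qed
  from this[OF mn] show "tilt m < tilt n"
    by (simp add: tilt_def)
qed

text \<open>Monotonicity combined with the fact that distinct integers differ by at least 1.\<close>

lemma tilt_diff_times_diff:
  "\<bar>tilt m - tilt n\<bar> \<le> of_int (m - n) * (tilt m - tilt n)"
proof -
  have abs_le: "\<bar>v\<bar> \<le> d * v" if "0 < v \<and> 1 \<le> d \<or> v < 0 \<and> d \<le> -1 \<or> v = 0" for d v :: real
    using that mult_right_mono[of 1 d v] mult_right_mono_neg[of d "-1" v] by auto
  have "0 < tilt m - tilt n \<and> 1 \<le> real_of_int (m - n) \<or>
      tilt m - tilt n < 0 \<and> real_of_int (m - n) \<le> -1 \<or> tilt m - tilt n = 0"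
    using strict_monoD[OF tilt_strict_mono, of m n] strict_monoD[OF tilt_strict_mono, of n m]
    by (cases m n rule: linorder_cases) auto
  then show ?thesis
    by (rule abs_le)
qed

definition grid_point :: "int \<times> int \<Rightarrow> real^3" where
  "grid_point k = vector [of_int (fst k), of_int (snd k), 0]"

text \<open>The horizontal part of the direction is \<open>(tilt m, tilt n)\<close> turned by a right angle. The quarter turn
  converts the monotonicity of the field \<open>(m, n) \<mapsto> (tilt m, tilt n)\<close> into separation of the lines.\<close>

definition grid_dir :: "int \<times> int \<Rightarrow> real^3" where
  "grid_dir k = vector [- tilt (snd k), tilt (fst k), 1]"

definition grid_line :: "int \<times> int \<Rightarrow> (real^3) set" where
  "grid_line k = range (\<lambda>t. grid_point k + t *\<^sub>R grid_dir k)"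

lemma grid_dir_nth [simp]:
  "grid_dir k $ 1 = - tilt (snd k)" "grid_dir k $ 2 = tilt (fst k)" "grid_dir k $ 3 = 1"
  by (simp_all add: grid_dir_def)

lemma grid_point_nth [simp]:
  "grid_point k $ 1 = of_int (fst k)" "grid_point k $ 2 = of_int (snd k)" "grid_point k $ 3 = 0"
  by (simp_all add: grid_point_def)

lemma grid_dir_nonzero: "grid_dir k \<noteq> 0"
  by (metis grid_dir_nth(3) zero_index zero_neq_one)

lemma inj_grid_dir: "inj grid_dir"
proof (rule injI)
  fix k k' assume "grid_dir k = grid_dir k'"
  then have "tilt (fst k) = tilt (fst k')" "tilt (snd k) = tilt (snd k')"
    by (metis grid_dir_nth(2), metis grid_dir_nth(1) neg_equal_iff_equal)
  then show "k = k'"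
    using strict_mono_eq[OF tilt_strict_mono] by (simp add: prod_eq_iff)
qed

lemma is_line_grid_line: "is_line (grid_line k)"
  unfolding grid_line_def by (rule is_line_range[OF grid_dir_nonzero])

lemma closed_grid_line: "closed (grid_line k)"
  by (metis is_line_grid_line is_line_def affine_hull_eq closed_affine_hull)

lemma grid_line_nonempty: "grid_line k \<noteq> {}"
  by (simp add: grid_line_def)

text \<open>The common normal of two of the lines is the cross product of their directions. Its horizontal part is
  \<open>(a, b)\<close>, the difference of the tilts, and because tilts increase with the index the displacement of
  the base points has inner product at least \<open>\<bar>a\<bar> + \<bar>b\<bar>\<close> with it: the two coordinates cannot
  cancel each other. The normal has length at most \<open>sqrt (65 / 64) * (\<bar>a\<bar> + \<bar>b\<bar>)\<close>, where the
  excess over 1 comes from its small vertical part. This bounds the distance below uniformly, although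
  neighbouring lines far out are almost parallel.\<close>

lemma grid_line_separation:
  assumes "k \<noteq> k'" "x \<in> grid_line k" "y \<in> grid_line k'"
  shows "64 / 65 \<le> (dist x y)\<^sup>2"
proof -
  obtain t s where x: "x = grid_point k + t *\<^sub>R grid_dir k" and y: "y = grid_point k' + s *\<^sub>R grid_dir k'"
    using assms(2,3) by (auto simp: grid_line_def)
  define a b where "a = tilt (fst k) - tilt (fst k')" and "b = tilt (snd k) - tilt (snd k')"
  define c where "c = tilt (snd k) * a - tilt (fst k) * b"
  \<comment> \<open>the cross product of the two directions\<close>
  define N :: "real^3" where "N = vector [a, b, c]"
  have "(x - y) \<bullet> N = of_int (fst k - fst k') * a + of_int (snd k - snd k') * b"
    by (simp add: x y N_def inner_vec_def sum_3 c_def a_def b_def algebra_simps)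
  then have ge: "\<bar>a\<bar> + \<bar>b\<bar> \<le> (x - y) \<bullet> N"
    using tilt_diff_times_diff[of "fst k" "fst k'"] tilt_diff_times_diff[of "snd k" "snd k'"]
    by (simp add: a_def b_def)
  have pos: "0 < \<bar>a\<bar> + \<bar>b\<bar>"
  proof -
    have "a \<noteq> 0 \<or> b \<noteq> 0"
      using assms(1) strict_mono_eq[OF tilt_strict_mono] by (auto simp: a_def b_def prod_eq_iff)
    then show ?thesis
      by auto
  qed
  have "\<bar>c\<bar> \<le> \<bar>tilt (snd k)\<bar> * \<bar>a\<bar> + \<bar>tilt (fst k)\<bar> * \<bar>b\<bar>"
    unfolding c_def by (metis abs_mult abs_triangle_ineq4)
  also have "\<dots> \<le> (1 / 8) * \<bar>a\<bar> + (1 / 8) * \<bar>b\<bar>"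
    by (intro add_mono mult_right_mono tilt_bound) auto
  finally have "c\<^sup>2 \<le> ((\<bar>a\<bar> + \<bar>b\<bar>) / 8)\<^sup>2"
    by (intro abs_le_square_iff[THEN iffD1]) simp
  moreover have "a\<^sup>2 + b\<^sup>2 \<le> (\<bar>a\<bar> + \<bar>b\<bar>)\<^sup>2"
    by (simp add: power2_sum)
  moreover have "(norm N)\<^sup>2 = a\<^sup>2 + b\<^sup>2 + c\<^sup>2"
    by (simp add: norm_vec_def L2_set_def N_def sum_3)
  ultimately have N: "(norm N)\<^sup>2 \<le> 65 / 64 * (\<bar>a\<bar> + \<bar>b\<bar>)\<^sup>2"
    by (simp add: power_divide)
  have "(\<bar>a\<bar> + \<bar>b\<bar>)\<^sup>2 \<le> ((x - y) \<bullet> N)\<^sup>2"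
    using ge pos by (intro power_mono) auto
  also have "\<dots> \<le> (norm (x - y) * norm N)\<^sup>2"
    by (metis Cauchy_Schwarz_ineq2 abs_ge_zero power2_abs power_mono)
  also have "\<dots> \<le> (dist x y)\<^sup>2 * (65 / 64 * (\<bar>a\<bar> + \<bar>b\<bar>)\<^sup>2)"
    unfolding power_mult_distrib dist_norm using N by (intro mult_left_mono) auto
  finally have "1 * (\<bar>a\<bar> + \<bar>b\<bar>)\<^sup>2 \<le> ((dist x y)\<^sup>2 * 65 / 64) * (\<bar>a\<bar> + \<bar>b\<bar>)\<^sup>2"
    by simp
  then have "1 \<le> (dist x y)\<^sup>2 * 65 / 64"
    using pos by (subst (asm) mult_le_cancel_right_pos) auto
  then show ?thesis
    by simp
qed

lemma disjoint_grid_cylinders: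
  assumes "k \<noteq> k'" "0 \<le> r" "4 * r\<^sup>2 < 64 / 65"
  shows "cylinder (grid_line k) r \<inter> cylinder (grid_line k') r = {}"
proof (rule ccontr)
  assume "\<not> ?thesis"
  then obtain z where z: "infdist z (grid_line k) \<le> r" "infdist z (grid_line k') \<le> r"
    by (auto simp: cylinder_def)
  obtain x where x: "x \<in> grid_line k" "infdist z (grid_line k) = dist z x"
    using infdist_attains_inf[OF closed_grid_line grid_line_nonempty] by metis
  obtain y where y: "y \<in> grid_line k'" "infdist z (grid_line k') = dist z y"
    using infdist_attains_inf[OF closed_grid_line grid_line_nonempty] by metis
  have "dist x y \<le> 2 * r"
    using z x(2) y(2) dist_triangle3[of x y z] by simp
  then have "(dist x y)\<^sup>2 \<le> (2 * r)\<^sup>2"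
    by (intro power_mono) auto
  then show False
    using grid_line_separation[OF assms(1) x(1) y(1)] assms(3) by (simp add: power_mult_distrib)
qed

lemma affine_multiple_bounded_imp_zero:
  fixes a b :: real
  assumes "\<And>t. \<bar>a + t * b\<bar> \<le> B"
  shows "b = 0"
proof (rule ccontr)
  assume "b \<noteq> 0"
  then have "\<bar>a + ((B + 1 - a) / b) * b\<bar> \<le> B"
    using assms by blast
  then show False
    using \<open>b \<noteq> 0\<close> by simp
qed

text \<open>A line contained in a cylinder stays at bounded distance from the axis, so it is parallel to it. This
  recovers the direction of the axis from the cylinder as a point set, whatever axis and radius it is
  presented with.\<close>

lemma direction_of_line_in_grid_cylinder:
  assumes "\<And>t. p + t *\<^sub>R u \<in> cylinder (grid_line k) r"
  shows "u = (u $ 3) *\<^sub>R grid_dir k"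
proof -
  have bound: "\<bar>(p $ i - grid_point k $ i - (p $ 3) * grid_dir k $ i) + t * (u $ i - (u $ 3) * grid_dir k $ i)\<bar> \<le> 2 * r"
    if "i = 1 \<or> i = 2" for i :: 3 and t
  proof -
    obtain y where "y \<in> grid_line k" "infdist (p + t *\<^sub>R u) (grid_line k) = dist (p + t *\<^sub>R u) y"
      using infdist_attains_inf[OF closed_grid_line grid_line_nonempty] by metis
    then obtain s where s: "dist (p + t *\<^sub>R u) (grid_point k + s *\<^sub>R grid_dir k) \<le> r"
      using assms[of t] by (auto simp: grid_line_def cylinder_def)
    define e where "e = p + t *\<^sub>R u - (grid_point k + s *\<^sub>R grid_dir k)"
    have e: "\<bar>e $ j\<bar> \<le> r" for j
      using s component_le_norm_cart[of e j] by (simp add: e_def dist_norm)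
    have g: "\<bar>grid_dir k $ i\<bar> \<le> 1"
      using that tilt_bound[of "fst k"] tilt_bound[of "snd k"] by auto
    have "(p $ i - grid_point k $ i - (p $ 3) * grid_dir k $ i) + t * (u $ i - (u $ 3) * grid_dir k $ i)
        = e $ i - e $ 3 * grid_dir k $ i"
      by (simp add: e_def algebra_simps)
    moreover have "\<bar>e $ 3 * grid_dir k $ i\<bar> \<le> r * 1"
      unfolding abs_mult using e[of 3] g by (intro mult_mono) auto
    ultimately show ?thesis
      using e[of i] by linarith
  qed
  have "u $ i - (u $ 3) * grid_dir k $ i = 0" if "i = 1 \<or> i = 2" for i :: 3
    by (rule affine_multiple_bounded_imp_zero[OF bound[OF that]])
  then show ?thesis
    by (auto simp: vec_eq_iff forall_3)
qed

lemma grid_cylinders_not_parallel: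
  assumes "k \<noteq> k'"
  shows "\<not> parallel_cylinders (cylinder (grid_line k) r) (cylinder (grid_line k') r)"
proof
  assume "parallel_cylinders (cylinder (grid_line k) r) (cylinder (grid_line k') r)"
  then obtain l m s s' a where l: "is_line l" "0 < s" "0 < s'" "cylinder (grid_line k) r = cylinder l s"
    "cylinder (grid_line k') r = cylinder m s'" "m = (\<lambda>x. a + x) ` l"
    unfolding parallel_cylinders_def affine_parallel_def by blast
  obtain p w where w: "norm w = 1" "l = range (\<lambda>t. p + t *\<^sub>R w)"
    using is_line_foot[OF l(1)] by blast
  have "p + t *\<^sub>R w \<in> l" for t
    unfolding w(2) by (rule rangeI)
  then have "p + t *\<^sub>R w \<in> cylinder (grid_line k) r" for t
    unfolding l(4) using l(2) by (simp add: cylinder_def)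
  then have 1: "w = (w $ 3) *\<^sub>R grid_dir k"
    by (rule direction_of_line_in_grid_cylinder)
  have "(a + p) + t *\<^sub>R w \<in> m" for t
    unfolding l(6) w(2) by (auto simp: image_image add.assoc)
  then have "(a + p) + t *\<^sub>R w \<in> cylinder (grid_line k') r" for t
    unfolding l(5) using l(3) by (simp add: cylinder_def)
  then have 2: "w = (w $ 3) *\<^sub>R grid_dir k'"
    by (rule direction_of_line_in_grid_cylinder)
  have "w $ 3 \<noteq> 0"
    using 1 w(1) by auto
  then have "grid_dir k = grid_dir k'"
    using 1 2 by (metis scaleR_cancel_left)
  then show False
    using assms inj_grid_dir by (simp add: inj_eq)
qed

lemma infdist_origin_grid_line:
  "(infdist 0 (grid_line (m, n)))\<^sup>2 =
     (of_int m)\<^sup>2 + (of_int n)\<^sup>2 - (of_int n * tilt m - of_int m * tilt n)\<^sup>2 / (1 + (tilt m)\<^sup>2 + (tilt n)\<^sup>2)"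
proof -
  have "(norm (0 - grid_point (m, n)))\<^sup>2 = (of_int m)\<^sup>2 + (of_int n)\<^sup>2"
    unfolding power2_norm_eq_inner by (simp add: inner_vec_def sum_3 power2_eq_square)
  moreover have "((0 - grid_point (m, n)) \<bullet> grid_dir (m, n))\<^sup>2 = (of_int n * tilt m - of_int m * tilt n)\<^sup>2"
    by (simp add: inner_vec_def sum_3 power2_eq_square algebra_simps)
  moreover have "(norm (grid_dir (m, n)))\<^sup>2 = 1 + (tilt m)\<^sup>2 + (tilt n)\<^sup>2"
    unfolding power2_norm_eq_inner by (simp add: inner_vec_def sum_3 power2_eq_square)
  ultimately show ?thesis
    using infdist_line_squared[OF grid_dir_nonzero, of 0 "grid_point (m, n)" "(m, n)"]
    by (simp add: grid_line_def)
qed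

text \<open>The lines are steep, so a line through a far-away grid point stays far from the origin; only grid
  points at distance of order \<open>R\<close> give cylinders that meet the ball of radius \<open>R\<close>.\<close>

lemma infdist_origin_grid_line_ge:
  "((of_int m)\<^sup>2 + (of_int n)\<^sup>2) / 2 \<le> (infdist 0 (grid_line (m, n)))\<^sup>2"
proof -
  define P s where "P = (real_of_int m)\<^sup>2 + (of_int n)\<^sup>2" and "s = (tilt m)\<^sup>2 + (tilt n)\<^sup>2"
  have "(of_int n * tilt m - of_int m * tilt n)\<^sup>2 + (of_int m * tilt m + of_int n * tilt n)\<^sup>2 = P * s"
    by (simp add: P_def s_def power2_eq_square algebra_simps)
  then have cs: "(of_int n * tilt m - of_int m * tilt n)\<^sup>2 \<le> P * s"
    by (smt (verit) zero_le_power2)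
  have "(tilt j)\<^sup>2 \<le> (1 / 8)\<^sup>2" for j
    using tilt_bound[of j] by (intro abs_le_square_iff[THEN iffD1]) simp
  from this[of m] this[of n] have s: "0 \<le> s" "s \<le> 1"
    by (simp_all add: s_def power_divide)
  have "P \<ge> 0"
    by (simp add: P_def)
  have "(of_int n * tilt m - of_int m * tilt n)\<^sup>2 / (1 + s) \<le> P * s / (1 + s)"
    using cs s by (intro divide_right_mono) auto
  also have "\<dots> \<le> P / 2"
    using s \<open>P \<ge> 0\<close> by (simp add: field_simps mult_left_le)
  finally show ?thesis
    unfolding infdist_origin_grid_line P_def[symmetric] by (simp add: s_def add.assoc)
qed

section \<open>Sums over the grid as integrals\<close>

text \<open>The grid \<open>(1 / R) \<int>\<^sup>2\<close> cuts the plane into squares of area \<open>1 / R\<^sup>2\<close> on which the integrand is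
  constant. Writing the lattice sum as an integral over a fixed plane allows passing to the limit
  \<open>R \<rightarrow> \<infinity>\<close> by dominated convergence.\<close>

lemma suminf_grid_eq_nn_integral:
  fixes f :: "int \<times> int \<Rightarrow> real" and e :: "nat \<Rightarrow> int \<times> int"
  assumes "bij e" "0 < R" "\<And>k. 0 \<le> f k"
  shows "(\<Sum>i. ennreal (f (e i))) =
    ennreal (R\<^sup>2) * (\<integral>\<^sup>+p. ennreal (f (\<lfloor>R * fst p\<rfloor>, \<lfloor>R * snd p\<rfloor>)) \<partial>lborel)"
proof -
  define cell :: "int \<times> int \<Rightarrow> (real \<times> real) set" where
    "cell k = {fst k / R ..< (fst k + 1) / R} \<times> {snd k / R ..< (snd k + 1) / R}" for k
  have cell: "p \<in> cell k \<longleftrightarrow> (\<lfloor>R * fst p\<rfloor>, \<lfloor>R * snd p\<rfloor>) = k" for p k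
    using \<open>0 < R\<close>
    by (cases p; cases k) (simp add: cell_def floor_eq_iff divide_le_eq less_divide_eq mult.commute)
  have sets: "cell k \<in> sets lborel" for k
    unfolding cell_def lborel_prod[symmetric] by (intro pair_measureI) auto
  have vol: "emeasure lborel (cell k) = ennreal (1 / R\<^sup>2)" for k
  proof -
    have "emeasure lborel (cell k) = ennreal (1 / R) * ennreal (1 / R)"
      unfolding cell_def lborel_prod[symmetric] using \<open>0 < R\<close>
      by (simp add: lborel.emeasure_pair_measure_Times divide_right_mono flip: diff_divide_distrib)
    then show ?thesis
      using \<open>0 < R\<close> by (simp add: power2_eq_square flip: ennreal_mult)
  qed
  have "ennreal (f (\<lfloor>R * fst p\<rfloor>, \<lfloor>R * snd p\<rfloor>)) = (\<Sum>i. ennreal (f (e i)) * indicator (cell (e i)) p)"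
    for p
  proof -
    obtain j where j: "e j = (\<lfloor>R * fst p\<rfloor>, \<lfloor>R * snd p\<rfloor>)"
      using \<open>bij e\<close> by (metis bij_pointE)
    have "p \<in> cell (e i) \<longleftrightarrow> i = j" for i
      unfolding cell j[symmetric] using \<open>bij e\<close> by (auto dest: bij_is_inj injD)
    then have "(\<Sum>i. ennreal (f (e i)) * indicator (cell (e i)) p) =
        (\<Sum>i\<in>{j}. ennreal (f (e i)) * indicator (cell (e i)) p)"
      by (intro suminf_finite) auto
    then show ?thesis
      by (simp add: cell j)
  qed
  then have "(\<integral>\<^sup>+p. ennreal (f (\<lfloor>R * fst p\<rfloor>, \<lfloor>R * snd p\<rfloor>)) \<partial>lborel) =
      (\<Sum>i. \<integral>\<^sup>+p. ennreal (f (e i)) * indicator (cell (e i)) p \<partial>lborel)"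
    using sets by (simp add: nn_integral_suminf)
  also have "\<dots> = (\<Sum>i. ennreal (f (e i)) * ennreal (1 / R\<^sup>2))"
    using sets by (simp add: nn_integral_cmult_indicator vol)
  also have "\<dots> = (\<Sum>i. ennreal (f (e i))) * ennreal (1 / R\<^sup>2)"
    by simp
  finally have "(\<integral>\<^sup>+p. ennreal (f (\<lfloor>R * fst p\<rfloor>, \<lfloor>R * snd p\<rfloor>)) \<partial>lborel) =
      (\<Sum>i. ennreal (f (e i))) * ennreal (1 / R\<^sup>2)" .
  moreover have "ennreal (R\<^sup>2) * (S * ennreal (1 / R\<^sup>2)) = S" for S
  proof -
    have "ennreal (R\<^sup>2) * ennreal (1 / R\<^sup>2) = 1"
      using \<open>0 < R\<close> by (simp flip: ennreal_mult)
    then show ?thesis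
      by (metis mult.commute mult.left_commute mult_1)
  qed
  ultimately show ?thesis
    by simp
qed

text \<open>Integrability yields the convergence of the series, without which its real value would be
  meaningless.\<close>

lemma suminf_grid_eq_integral:
  fixes f :: "int \<times> int \<Rightarrow> real" and e :: "nat \<Rightarrow> int \<times> int"
  assumes "bij e" "0 < R" "\<And>k. 0 \<le> f k"
    and int: "integrable lborel (\<lambda>p. f (\<lfloor>R * fst p\<rfloor>, \<lfloor>R * snd p\<rfloor>))"
  shows "(\<Sum>i. f (e i)) = R\<^sup>2 * (\<integral>p. f (\<lfloor>R * fst p\<rfloor>, \<lfloor>R * snd p\<rfloor>) \<partial>lborel)"
proof -
  define J where "J = (\<integral>p. f (\<lfloor>R * fst p\<rfloor>, \<lfloor>R * snd p\<rfloor>) \<partial>lborel)"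
  have "0 \<le> J"
    using assms(3) by (simp add: J_def)
  have "(\<Sum>i. ennreal (f (e i))) = ennreal (R\<^sup>2) * ennreal J"
    unfolding J_def using suminf_grid_eq_nn_integral[of e R f, OF assms(1-3)] nn_integral_eq_integral[OF int] assms(3)
    by simp
  also have "\<dots> = ennreal (R\<^sup>2 * J)"
    using \<open>0 \<le> J\<close> by (simp add: ennreal_mult)
  finally have *: "(\<Sum>i. ennreal (f (e i))) = ennreal (R\<^sup>2 * J)" .
  then have "summable (\<lambda>i. f (e i))"
    using assms(3) by (intro summable_suminf_not_top) auto
  then show ?thesis
    using * assms(3) \<open>0 \<le> J\<close> by (simp add: suminf_ennreal2 suminf_nonneg J_def)
qed

lemma borel_measurable_floor_grid:
  fixes f :: "int \<times> int \<Rightarrow> real"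
  shows "(\<lambda>p. f (\<lfloor>R * fst p\<rfloor>, \<lfloor>R * snd p\<rfloor>)) \<in> borel_measurable (borel :: (real \<times> real) measure)"
proof -
  have fl: "(\<lambda>p. \<lfloor>R * fst p\<rfloor>) \<in> measurable (borel :: (real \<times> real) measure) (count_space UNIV)"
    "(\<lambda>p. \<lfloor>R * snd p\<rfloor>) \<in> measurable (borel :: (real \<times> real) measure) (count_space UNIV)"
    unfolding borel_prod[symmetric] by measurable
  have "(\<lambda>p. f (m, \<lfloor>R * snd p\<rfloor>)) \<in> borel_measurable (borel :: (real \<times> real) measure)" for m
    by (rule measurable_compose[OF fl(2)]) simp
  from measurable_compose_countable[OF this fl(1)] show ?thesis
    by simp
qed

section \<open>The density of the packing\<close>

lemma floor_scale_tendsto: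
  fixes x :: real
  shows "((\<lambda>R. of_int \<lfloor>R * x\<rfloor> / R) \<longlongrightarrow> x) at_top"
proof (rule tendsto_sandwich)
  show "\<forall>\<^sub>F R in at_top. x - 1 / R \<le> of_int \<lfloor>R * x\<rfloor> / R"
    using eventually_gt_at_top[of 0]
  proof eventually_elim
    case (elim R)
    have "(R * x - 1) / R \<le> of_int \<lfloor>R * x\<rfloor> / R"
      using elim by (intro divide_right_mono) linarith+
    then show ?case
      using elim by (simp add: diff_divide_distrib)
  qed
  show "\<forall>\<^sub>F R in at_top. of_int \<lfloor>R * x\<rfloor> / R \<le> x"
    using eventually_gt_at_top[of 0]
    by eventually_elim (simp add: divide_le_eq mult.commute)
  have "((\<lambda>R. x - 1 / R) \<longlongrightarrow> x - 0) at_top"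
    by (intro tendsto_intros tendsto_divide_0[OF tendsto_const] filterlim_at_top_imp_at_infinity filterlim_ident)
  then show "((\<lambda>R. x - 1 / R) \<longlongrightarrow> x) at_top"
    by simp
qed simp

lemma tilt_floor_scale_tendsto: "((\<lambda>R. tilt \<lfloor>R * x\<rfloor>) \<longlongrightarrow> sgn x / 8) at_top"
proof (cases "x = 0")
  case True
  then show ?thesis
    by (simp add: tilt_def)
next
  case False
  let ?q = "\<lambda>R. of_int \<lfloor>R * x\<rfloor> / R"
  have "((\<lambda>R. ?q R / (8 * (1 / R + \<bar>?q R\<bar>))) \<longlongrightarrow> x / (8 * (0 + \<bar>x\<bar>))) at_top"
    using False
    by (intro tendsto_intros floor_scale_tendsto tendsto_divide_0[OF tendsto_const]
        filterlim_at_top_imp_at_infinity filterlim_ident) auto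
  also have "x / (8 * (0 + \<bar>x\<bar>)) = sgn x / 8"
    using False by (simp add: sgn_if)
  finally show ?thesis
  proof (rule Lim_transform_eventually)
    show "\<forall>\<^sub>F R in at_top. ?q R / (8 * (1 / R + \<bar>?q R\<bar>)) = tilt \<lfloor>R * x\<rfloor>"
      using eventually_gt_at_top[of 0]
    proof eventually_elim
      case (elim R)
      have "8 * (1 / R + \<bar>?q R\<bar>) = 8 * (1 + \<bar>of_int \<lfloor>R * x\<rfloor>\<bar>) / R"
        using elim by (simp add: abs_divide add_divide_distrib)
      then show ?case
        using elim by (simp add: tilt_def)
    qed
  qed
qed

text \<open>Seen at scale \<open>R\<close>, the line of the packing that passes near \<open>R * p\<close> becomes in the limit the line
  through \<open>p\<close> with direction \<open>(- sgn y / 8, sgn x / 8, 1)\<close>, where \<open>p = (x, y)\<close>. This is the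
  square of its distance from the origin.\<close>

definition limit_distance_squared :: "real \<times> real \<Rightarrow> real" where
  "limit_distance_squared p = (fst p)\<^sup>2 + (snd p)\<^sup>2 -
     (snd p * (sgn (fst p) / 8) - fst p * (sgn (snd p) / 8))\<^sup>2
       / (1 + (sgn (fst p) / 8)\<^sup>2 + (sgn (snd p) / 8)\<^sup>2)"

lemma limit_distance_squared_le: "limit_distance_squared p \<le> (norm p)\<^sup>2"
  by (simp add: limit_distance_squared_def norm_prod_def)

lemma limit_distance_squared_nonneg: "0 \<le> limit_distance_squared p"
proof -
  obtain x y where p: "p = (x, y)"
    by force
  define a b where "a = sgn x / 8" and "b = sgn y / 8"
  have "a\<^sup>2 \<le> 1 / 64" "b\<^sup>2 \<le> 1 / 64"
    by (simp_all add: a_def b_def sgn_if power_divide)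
  then have "a\<^sup>2 + b\<^sup>2 \<le> 1"
    by simp
  have "0 < 1 + a\<^sup>2 + b\<^sup>2"
    by (intro add_pos_nonneg) auto
  then have "(y * a - x * b)\<^sup>2 / (1 + a\<^sup>2 + b\<^sup>2) \<le> (y * a - x * b)\<^sup>2 / 1"
    by (intro divide_left_mono) auto
  also have "\<dots> \<le> (y * a - x * b)\<^sup>2 + (x * a + y * b)\<^sup>2"
    by simp
  also have "\<dots> = (x\<^sup>2 + y\<^sup>2) * (a\<^sup>2 + b\<^sup>2)"
    by (simp add: power2_eq_square algebra_simps)
  also have "\<dots> \<le> (x\<^sup>2 + y\<^sup>2) * 1"
    using \<open>a\<^sup>2 + b\<^sup>2 \<le> 1\<close> by (intro mult_left_mono) auto
  finally show ?thesis
    by (simp add: limit_distance_squared_def p a_def b_def)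
qed

lemma scaled_distance_tendsto:
  "((\<lambda>R. infdist 0 (grid_line (\<lfloor>R * fst p\<rfloor>, \<lfloor>R * snd p\<rfloor>)) / R)
           \<longlongrightarrow> sqrt (limit_distance_squared p)) at_top"
proof -
  let ?D = "\<lambda>R. infdist 0 (grid_line (\<lfloor>R * fst p\<rfloor>, \<lfloor>R * snd p\<rfloor>))"
  let ?x = "\<lambda>R. of_int \<lfloor>R * fst p\<rfloor> / R" and ?y = "\<lambda>R. of_int \<lfloor>R * snd p\<rfloor> / R"
  let ?a = "\<lambda>R. tilt \<lfloor>R * fst p\<rfloor>" and ?b = "\<lambda>R. tilt \<lfloor>R * snd p\<rfloor>"
  have "1 + (sgn (fst p) / 8)\<^sup>2 + (sgn (snd p) / 8)\<^sup>2 \<noteq> 0"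
    by (smt (verit) zero_le_power2)
  then have "((\<lambda>R. (?x R)\<^sup>2 + (?y R)\<^sup>2 - (?y R * ?a R - ?x R * ?b R)\<^sup>2 / (1 + (?a R)\<^sup>2 + (?b R)\<^sup>2))
      \<longlongrightarrow> limit_distance_squared p) at_top"
    unfolding limit_distance_squared_def
    by (intro tendsto_intros floor_scale_tendsto tilt_floor_scale_tendsto)
  then have "((\<lambda>R. sqrt ((?x R)\<^sup>2 + (?y R)\<^sup>2 - (?y R * ?a R - ?x R * ?b R)\<^sup>2 / (1 + (?a R)\<^sup>2 + (?b R)\<^sup>2)))
      \<longlongrightarrow> sqrt (limit_distance_squared p)) at_top"
    by (rule tendsto_real_sqrt)
  then show ?thesis
  proof (rule Lim_transform_eventually)
    show "\<forall>\<^sub>F R in at_top. sqrt ((?x R)\<^sup>2 + (?y R)\<^sup>2 - (?y R * ?a R - ?x R * ?b R)\<^sup>2 / (1 + (?a R)\<^sup>2 + (?b R)\<^sup>2))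
        = ?D R / R"
      using eventually_gt_at_top[of 0]
    proof eventually_elim
      case (elim R)
      have eq: "?y R * ?a R - ?x R * ?b R = (of_int \<lfloor>R * snd p\<rfloor> * ?a R - of_int \<lfloor>R * fst p\<rfloor> * ?b R) / R"
        by (simp add: diff_divide_distrib)
      have "(?x R)\<^sup>2 + (?y R)\<^sup>2 - (?y R * ?a R - ?x R * ?b R)\<^sup>2 / (1 + (?a R)\<^sup>2 + (?b R)\<^sup>2) = (?D R)\<^sup>2 / R\<^sup>2"
        unfolding eq infdist_origin_grid_line
        by (simp only: power_divide) (simp add: diff_divide_distrib add_divide_distrib mult.commute)
      then show ?case
        using elim by (simp add: real_sqrt_divide infdist_nonneg)
    qed
  qed
qed

definition cylinder_volume :: "real \<Rightarrow> real \<Rightarrow> int \<times> int \<Rightarrow> real" where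
  "cylinder_volume r R k = measure lebesgue (cylinder (grid_line k) r \<inter> cball 0 R)"

text \<open>Half the length of the chord that the unit ball cuts out of the limiting line through \<open>p\<close>.\<close>

definition limit_chord :: "real \<times> real \<Rightarrow> real" where
  "limit_chord p = sqrt (max 0 (1 - limit_distance_squared p))"

text \<open>Relative to the ball the radius of the cylinder tends to 0, so the two bounds on the volume have the
  same limit.\<close>

lemma scaled_volume_tendsto:
  assumes "0 \<le> r"
  shows "((\<lambda>R. cylinder_volume r R (\<lfloor>R * fst p\<rfloor>, \<lfloor>R * snd p\<rfloor>) / R)
           \<longlongrightarrow> 2 * pi * r\<^sup>2 * limit_chord p) at_top"
proof -
  let ?k = "\<lambda>R. (\<lfloor>R * fst p\<rfloor>, \<lfloor>R * snd p\<rfloor>)"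
  let ?D = "\<lambda>R. infdist 0 (grid_line (?k R))"
  have r0: "((\<lambda>R. r / R) \<longlongrightarrow> 0) at_top"
    by (intro tendsto_divide_0[OF tendsto_const] filterlim_at_top_imp_at_infinity filterlim_ident)
  have sq: "(sqrt (limit_distance_squared p))\<^sup>2 = limit_distance_squared p"
    by (simp add: limit_distance_squared_nonneg)
  have scale: "sqrt (max 0 (R\<^sup>2 - d\<^sup>2)) / R = sqrt (max 0 (1 - (d / R)\<^sup>2))" if "0 < R" for d R :: real
  proof -
    have "sqrt (max 0 (1 - (d / R)\<^sup>2)) = sqrt (max 0 (R\<^sup>2 - d\<^sup>2) / R\<^sup>2)"
      using that by (simp add: max_def field_simps power_divide)
    then show ?thesis
      using that by (simp add: real_sqrt_divide)
  qed
  show ?thesis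
  proof (rule tendsto_sandwich)
    show "\<forall>\<^sub>F R in at_top. 2 * pi * r\<^sup>2 * sqrt (max 0 (1 - (?D R / R + r / R)\<^sup>2)) \<le> cylinder_volume r R (?k R) / R"
      using eventually_gt_at_top[of 0]
    proof eventually_elim
      case (elim R)
      have "2 * pi * r\<^sup>2 * sqrt (max 0 (R\<^sup>2 - (?D R + r)\<^sup>2)) / R \<le> cylinder_volume r R (?k R) / R"
        unfolding cylinder_volume_def using elim assms(1)
        by (intro divide_right_mono measure_cylinder_Int_cball_ge is_line_grid_line) auto
      then show ?case
        unfolding add_divide_distrib[symmetric] scale[OF elim, symmetric] by simp
    qed
    show "\<forall>\<^sub>F R in at_top. cylinder_volume r R (?k R) / R \<le> 2 * pi * r\<^sup>2 * sqrt (max 0 (1 - (max 0 (?D R / R - r / R))\<^sup>2))"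
      using eventually_gt_at_top[of 0]
    proof eventually_elim
      case (elim R)
      have "cylinder_volume r R (?k R) / R \<le> 2 * pi * r\<^sup>2 * sqrt (max 0 (R\<^sup>2 - (max 0 (?D R - r))\<^sup>2)) / R"
        unfolding cylinder_volume_def using elim assms(1)
        by (intro divide_right_mono measure_cylinder_Int_cball_le is_line_grid_line) auto
      moreover have eq: "max 0 (?D R / R - r / R) = max 0 (?D R - r) / R"
        using elim by (simp add: max_def diff_divide_distrib divide_le_eq)
      ultimately show ?case
        unfolding eq scale[OF elim, symmetric] by simp
    qed
    show "((\<lambda>R. 2 * pi * r\<^sup>2 * sqrt (max 0 (1 - (?D R / R + r / R)\<^sup>2))) \<longlongrightarrow> 2 * pi * r\<^sup>2 * limit_chord p) at_top"
    proof -
      have "((\<lambda>R. 2 * pi * r\<^sup>2 * sqrt (max 0 (1 - (?D R / R + r / R)\<^sup>2)))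
          \<longlongrightarrow> 2 * pi * r\<^sup>2 * sqrt (max 0 (1 - (sqrt (limit_distance_squared p) + 0)\<^sup>2))) at_top"
        by (intro tendsto_intros scaled_distance_tendsto r0)
      then show ?thesis
        by (simp add: limit_chord_def sq)
    qed
    show "((\<lambda>R. 2 * pi * r\<^sup>2 * sqrt (max 0 (1 - (max 0 (?D R / R - r / R))\<^sup>2))) \<longlongrightarrow> 2 * pi * r\<^sup>2 * limit_chord p) at_top"
    proof -
      have "((\<lambda>R. 2 * pi * r\<^sup>2 * sqrt (max 0 (1 - (max 0 (?D R / R - r / R))\<^sup>2)))
          \<longlongrightarrow> 2 * pi * r\<^sup>2 * sqrt (max 0 (1 - (max 0 (sqrt (limit_distance_squared p) - 0))\<^sup>2))) at_top"
        by (intro tendsto_intros scaled_distance_tendsto r0)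
      then show ?thesis
        by (simp add: limit_chord_def limit_distance_squared_nonneg max_absorb2)
    qed
  qed
qed

lemma scaled_volume_bound:
  assumes "0 \<le> r" "r \<le> R" "1 \<le> R"
  shows "cylinder_volume r R (\<lfloor>R * fst p\<rfloor>, \<lfloor>R * snd p\<rfloor>) / R \<le> 2 * pi * r\<^sup>2 * indicator (cball 0 5) p"
proof -
  define m n where "m = \<lfloor>R * fst p\<rfloor>" and "n = \<lfloor>R * snd p\<rfloor>"
  define d where "d = max 0 (infdist 0 (grid_line (m, n)) - r)"
  have le: "cylinder_volume r R (m, n) \<le> 2 * pi * r\<^sup>2 * sqrt (max 0 (R\<^sup>2 - d\<^sup>2))"
    unfolding cylinder_volume_def d_def using assms by (intro measure_cylinder_Int_cball_le is_line_grid_line) auto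
  have nonneg: "0 \<le> 2 * pi * r\<^sup>2"
    by simp
  show ?thesis
  \<comment> \<open>any radius from \<open>sqrt 20\<close> on would do: outside, the axis is farther than \<open>2 * R \<ge> R + r\<close> from the origin\<close>
  proof (cases "p \<in> cball 0 5")
    case True
    have "sqrt (max 0 (R\<^sup>2 - d\<^sup>2)) \<le> R"
      using assms by (intro real_le_lsqrt) auto
    then have "2 * pi * r\<^sup>2 * sqrt (max 0 (R\<^sup>2 - d\<^sup>2)) \<le> 2 * pi * r\<^sup>2 * R"
      using nonneg by (rule mult_left_mono)
    then have "cylinder_volume r R (m, n) \<le> 2 * pi * r\<^sup>2 * R"
      using le by (rule order_trans[rotated])
    then have "cylinder_volume r R (m, n) / R \<le> 2 * pi * r\<^sup>2"
      using assms by (simp add: pos_divide_le_eq)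
    then show ?thesis
      using True by (simp add: m_def n_def)
  next
    case False
    have fl: "(R * x)\<^sup>2 \<le> 2 * (real_of_int \<lfloor>R * x\<rfloor>)\<^sup>2 + 2" for x
    proof -
      define z where "z = R * x - of_int \<lfloor>R * x\<rfloor>"
      have z: "\<bar>z\<bar> \<le> 1"
        unfolding z_def by linarith
      then have "z\<^sup>2 \<le> 1"
        by (simp add: abs_square_le_1)
      moreover have "(R * x)\<^sup>2 + (of_int \<lfloor>R * x\<rfloor> - z)\<^sup>2 = 2 * (real_of_int \<lfloor>R * x\<rfloor>)\<^sup>2 + 2 * z\<^sup>2"
        by (simp add: z_def power2_eq_square algebra_simps)
      ultimately show ?thesis
        by (smt (verit) zero_le_power2)
    qed
    have "5\<^sup>2 < (norm p)\<^sup>2"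
      using False by (intro power_strict_mono) auto
    then have "R\<^sup>2 * 25 < R\<^sup>2 * ((fst p)\<^sup>2 + (snd p)\<^sup>2)"
      using assms by (simp add: norm_prod_def)
    also have "\<dots> = (R * fst p)\<^sup>2 + (R * snd p)\<^sup>2"
      by (simp add: power_mult_distrib algebra_simps)
    also have "\<dots> \<le> 2 * ((of_int m)\<^sup>2 + (of_int n)\<^sup>2) + 4"
      using fl[of "fst p"] fl[of "snd p"] by (simp add: m_def n_def)
    finally have "R\<^sup>2 * 25 < 4 * (infdist 0 (grid_line (m, n)))\<^sup>2 + 4"
      using infdist_origin_grid_line_ge[of m n] by simp
    moreover have "1 \<le> R\<^sup>2"
      using assms by simp
    ultimately have "(2 * R)\<^sup>2 < (infdist 0 (grid_line (m, n)))\<^sup>2"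
      by (simp add: power_mult_distrib)
    then have "2 * R < infdist 0 (grid_line (m, n))"
      by (rule power2_less_imp_less) (rule infdist_nonneg)
    then have "R \<le> d"
      using assms by (simp add: d_def)
    then have "R\<^sup>2 \<le> d\<^sup>2"
      using assms by (intro power_mono) auto
    then have "cylinder_volume r R (m, n) \<le> 0"
      using le by simp
    then show ?thesis
      using False assms by (simp add: m_def n_def divide_le_0_iff)
  qed
qed

lemma
  assumes "0 < r"
  shows integral_scaled_volume_tendsto:
      "((\<lambda>R. \<integral>p. cylinder_volume r R (\<lfloor>R * fst p\<rfloor>, \<lfloor>R * snd p\<rfloor>) / R \<partial>lborel)
         \<longlongrightarrow> 2 * pi * r\<^sup>2 * (\<integral>p. limit_chord p \<partial>lborel)) at_top"
    and integrable_scaled_volume: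
      "r \<le> R \<Longrightarrow> 1 \<le> R \<Longrightarrow>
         integrable lborel (\<lambda>p. cylinder_volume r R (\<lfloor>R * fst p\<rfloor>, \<lfloor>R * snd p\<rfloor>))"
    and integrable_limit_chord: "integrable lborel limit_chord"
proof -
  let ?v = "\<lambda>R p. cylinder_volume r R (\<lfloor>R * fst p\<rfloor>, \<lfloor>R * snd p\<rfloor>) / R"
  let ?w = "\<lambda>p :: real \<times> real. 2 * pi * r\<^sup>2 * indicator (cball 0 5) p :: real"
  have meas: "?v R \<in> borel_measurable lborel" for R
    using borel_measurable_floor_grid[of "\<lambda>k. cylinder_volume r R k / R" R] by simp
  have w: "integrable lborel ?w"
    by (intro integrable_mult_right integrable_real_indicator) (simp, rule emeasure_lborel_cball_finite)
  have lim_meas: "limit_chord \<in> borel_measurable lborel"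
    unfolding limit_chord_def[abs_def] limit_distance_squared_def lborel_prod[symmetric] by measurable
  then have lim_meas': "(\<lambda>p. 2 * pi * r\<^sup>2 * limit_chord p) \<in> borel_measurable lborel"
    by simp
  have norm: "norm (?v R p) \<le> ?w p" if "r \<le> R" "1 \<le> R" for R p
    using scaled_volume_bound[of r R p] that assms by (simp add: cylinder_volume_def)
  then have bound: "\<forall>\<^sub>F R in at_top. AE p in lborel. norm (?v R p) \<le> ?w p"
    using eventually_ge_at_top[of "max r 1"] by (auto elim!: eventually_mono)
  have lim: "AE p in lborel. ((\<lambda>R. ?v R p) \<longlongrightarrow> 2 * pi * r\<^sup>2 * limit_chord p) at_top"
    using assms by (intro AE_I2 scaled_volume_tendsto) simp
  show "((\<lambda>R. \<integral>p. ?v R p \<partial>lborel) \<longlongrightarrow> 2 * pi * r\<^sup>2 * (\<integral>p. limit_chord p \<partial>lborel)) at_top"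
    using integral_dominated_convergence_at_top[OF lim_meas' meas w lim bound] by simp
  have "integrable lborel (\<lambda>p. 2 * pi * r\<^sup>2 * limit_chord p)"
    by (rule integrable_dominated_convergence_at_top[OF lim_meas' meas w lim bound])
  then show "integrable lborel limit_chord"
    using assms by simp
  assume R: "r \<le> R" "1 \<le> R"
  have "integrable lborel (?v R)"
    by (rule Bochner_Integration.integrable_bound[OF w meas]) (use norm[OF R] in auto)
  from integrable_mult_right[OF this, of R]
  show "integrable lborel (\<lambda>p. cylinder_volume r R (\<lfloor>R * fst p\<rfloor>, \<lfloor>R * snd p\<rfloor>))"
    using R by simp
qed

lemma local_density_grid_tendsto:
  assumes "0 < r" "bij e"
  shows "(local_density (\<lambda>i. cylinder (grid_line (e i)) r)
           \<longlongrightarrow> 3 / 2 * r\<^sup>2 * (\<integral>p. limit_chord p \<partial>lborel)) at_top"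
proof -
  let ?J = "\<lambda>R. \<integral>p. cylinder_volume r R (\<lfloor>R * fst p\<rfloor>, \<lfloor>R * snd p\<rfloor>) / R \<partial>lborel"
  have "((\<lambda>R. 3 / (4 * pi) * ?J R) \<longlongrightarrow> 3 / (4 * pi) * (2 * pi * r\<^sup>2 * (\<integral>p. limit_chord p \<partial>lborel))) at_top"
    by (intro tendsto_intros integral_scaled_volume_tendsto assms)
  also have "3 / (4 * pi) * (2 * pi * r\<^sup>2 * (\<integral>p. limit_chord p \<partial>lborel)) = 3 / 2 * r\<^sup>2 * (\<integral>p. limit_chord p \<partial>lborel)"
    by simp
  finally show ?thesis
  proof (rule Lim_transform_eventually)
    show "\<forall>\<^sub>F R in at_top. 3 / (4 * pi) * ?J R = local_density (\<lambda>i. cylinder (grid_line (e i)) r) R"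
      using eventually_ge_at_top[of "max r 1"]
    proof eventually_elim
      case (elim R)
      then have R: "r \<le> R" "1 \<le> R" "0 < R"
        by auto
      define K where "K = (\<integral>p. cylinder_volume r R (\<lfloor>R * fst p\<rfloor>, \<lfloor>R * snd p\<rfloor>) \<partial>lborel)"
      have "(\<Sum>i. cylinder_volume r R (e i)) =
          R\<^sup>2 * (\<integral>p. cylinder_volume r R (\<lfloor>R * fst p\<rfloor>, \<lfloor>R * snd p\<rfloor>) \<partial>lborel)"
        by (rule suminf_grid_eq_integral[OF assms(2) R(3) _ integrable_scaled_volume[OF assms(1) R(1,2)]])
          (simp add: cylinder_volume_def)
      then have "local_density (\<lambda>i. cylinder (grid_line (e i)) r) R = R\<^sup>2 * K / (4 * pi * R ^ 3 / 3)"
        by (simp add: local_density_def cylinder_volume_def K_def)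
      also have "\<dots> = 3 / (4 * pi) * (K / R)"
        using R(3) by (simp add: power2_eq_square power3_eq_cube)
      also have "K / R = ?J R"
        by (simp add: K_def)
      finally show ?case
        by (rule sym)
    qed
  qed
qed

text \<open>A line through \<open>p\<close> is no farther from the origin than \<open>p\<close>, so the half-chord is at least the height
  \<open>sqrt (1 - (norm p)\<^sup>2)\<close> of the unit hemisphere over \<open>p\<close>. The union of two cylinders inscribed in the half-ball,
  whose radii and heights come from the right triangle with sides 3, 4, 5, has enough volume for the bound.\<close>

lemma integral_limit_chord_gt: "65 / 48 < (\<integral>p. limit_chord p \<partial>lborel)"
proof -
  let ?s = "\<lambda>p :: real \<times> real. 3 / 5 * indicator (cball 0 (4 / 5)) p + 1 / 5 * indicator (cball 0 (3 / 5)) p :: real"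
  have ball: "emeasure lborel (cball (0 :: real \<times> real) \<rho>) < \<infinity>" for \<rho>
    by (rule emeasure_lborel_cball_finite)
  have int: "integrable lborel ?s"
    by (intro Bochner_Integration.integrable_add integrable_mult_right integrable_real_indicator ball) auto
  have chord: "c \<le> limit_chord p" if "norm p \<le> \<rho>" "0 \<le> c" "\<rho>\<^sup>2 + c\<^sup>2 = 1" for p c \<rho>
  proof -
    have "(norm p)\<^sup>2 \<le> \<rho>\<^sup>2"
      using that(1) by (intro power_mono) auto
    then have "c\<^sup>2 \<le> 1 - limit_distance_squared p"
      using limit_distance_squared_le[of p] that(3) by linarith
    then show ?thesis
      unfolding limit_chord_def by (intro real_le_rsqrt) auto
  qed
  have "?s p \<le> limit_chord p" for p
  proof -
    have "0 \<le> limit_chord p"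
      by (simp add: limit_chord_def)
    then show ?thesis
      using chord[of p "4 / 5" "3 / 5"] chord[of p "3 / 5" "4 / 5"]
      by (auto simp: indicator_def power_divide)
  qed
  then have "(\<integral>p. ?s p \<partial>lborel) \<le> (\<integral>p. limit_chord p \<partial>lborel)"
    using integrable_limit_chord[of 1] int by (intro integral_mono) auto
  moreover have "(\<integral>p. ?s p \<partial>lborel) = 3 / 5 * (pi * (4 / 5)\<^sup>2) + 1 / 5 * (pi * (3 / 5)\<^sup>2)"
    using ball by (simp add: content_cball unit_ball_vol_2 power_divide)
  ultimately show ?thesis
    using pi_gt3 by (simp add: power_divide)
qed

theorem theorem3p6:
  shows "\<exists>C :: nat \<Rightarrow> (real^3) set.
           cylinder_packing C \<and>
           has_global_density C (1 / 2) \<and>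
           (\<forall>i j. i \<noteq> j \<longrightarrow> \<not> parallel_cylinders (C i) (C j))"
proof -
  define I where "I = (\<integral>p. limit_chord p \<partial>lborel)"
  have I: "65 / 48 < I"
    using integral_limit_chord_gt by (simp add: I_def)
  \<comment> \<open>the radius for which the limiting density \<open>3 / 2 * r\<^sup>2 * I\<close> is exactly \<open>1 / 2\<close>\<close>
  define r where "r = sqrt (1 / (3 * I))"
  have r: "0 < r" "r\<^sup>2 = 1 / (3 * I)"
    using I by (simp_all add: r_def)
  have r_small: "4 * r\<^sup>2 < 64 / 65"
    using I by (simp add: r(2) field_simps)
  define e :: "nat \<Rightarrow> int \<times> int" where "e = from_nat_into UNIV"
  have "infinite (UNIV :: (int \<times> int) set)"
    by (simp add: finite_prod infinite_UNIV_int)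
  then have e: "bij e"
    unfolding e_def by (intro bij_betw_from_nat_into) auto
  then have e_neq: "e i \<noteq> e j" if "i \<noteq> j" for i j
    using that by (auto dest: bij_is_inj injD)
  define C where "C i = cylinder (grid_line (e i)) r" for i
  have "C i \<inter> C j = {}" if "i \<noteq> j" for i j
    unfolding C_def using disjoint_grid_cylinders[OF e_neq[OF that] _ r_small] r(1) by simp
  then have "disjoint_family (\<lambda>i. interior (C i))"
    unfolding disjoint_family_on_def by (metis Int_mono interior_subset subset_empty)
  then have "cylinder_packing C"
    unfolding cylinder_packing_def C_def using r(1) is_line_grid_line by blast
  moreover have "has_global_density C (1 / 2)"
  proof -
    have density: "3 / 2 * r\<^sup>2 * I = 1 / 2"
      using I by (simp add: r(2))
    show ?thesis
      unfolding has_global_density_def C_def[abs_def]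
      using local_density_grid_tendsto[OF r(1) e, folded I_def] unfolding density .
  qed
  moreover have "\<forall>i j. i \<noteq> j \<longrightarrow> \<not> parallel_cylinders (C i) (C j)"
    unfolding C_def using grid_cylinders_not_parallel[OF e_neq] by blast
  ultimately show ?thesis
    by blast
qed

end
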